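(* Let $\mathcal{A}$ be a canonical scattering algorithm whose destination function satisfies $k_{\mathcal{A}}(C,P)=O(|C|^K)$ for some $K\in\mathbb{N}$. Then $\mathcal{A}$ is optimal in terms of random bits: the expected number of random bits needed to scatter $n$ robots is $O(n\log n)$.
   Context: Mobile robot model: robots are points in the plane; anonymous, oblivious, disoriented (robots at the same point share the same local coordinate system); fully synchronous rounds in which every robot Looks (snapshot of all positions), Computes a destination and Moves toward it. A configuration $C$ is the multiset of robot positions, $|C|$ its number of robots; $C$ is scattered when no two robots share a position. A scattering algorithm eventually reaches a scattered configuration from any initial configuration. Random bits: choosing uniformly among $k$ possibilities uses $\log_2 k$ bits; bits used by robots alone at their position are not counted. Every scattering algorithm needs at least $n\log_2 n$ random bits in expectation to scatter $n$ robots, so $O(n\log n)$ is optimal. A canonical scattering algorithm $\mathcal{A}$: each robot observes the configuration $C$ and its position $P$, computes a set $Pos$ of $k_{\mathcal{A}}(C,P)$ distinct destinations (identical for all robots at $P$) such that no point of $Pos$ may be chosen by a robot not currently at $P$, and moves toward a point of $Pos$ chosen uniformly at random; $k_{\mathcal{A}}$ is the destination function. *)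

theory Defs
  imports "HOL-Probability.Probability" "HOL-Library.Multiset"
begin

type_synonym point = "real ^ 2"

text \<open>
  A local coordinate system is the map from global to local coordinates. Robots are disoriented:
  origin, unit of length, axes and chirality are all arbitrary, so any similarity of the plane
  may occur.
\<close>

definition frames :: "(point \<Rightarrow> point) set" where
  "frames = {\<phi>. bij \<phi> \<and> (\<exists>r>0. \<forall>u v. dist (\<phi> u) (\<phi> v) = r * dist u v)}"

text \<open>
  An algorithm in canonical form: from the observed configuration and the robot's own observed
  position, both in local coordinates, it computes the set \<open>Pos\<close> of possible destinations, again
  in local coordinates. Being a function of the current snapshot alone, it is anonymous and
  oblivious.
\<close>

type_synonym algorithm = "point multiset \<Rightarrow> point \<Rightarrow> point set"

definition dest_count :: "algorithm \<Rightarrow> point multiset \<Rightarrow> point \<Rightarrow> nat" where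
  "dest_count A C P = card (A C P)"

text \<open>The set \<open>Pos\<close> in global coordinates, for robots at \<open>P\<close> whose coordinate system is \<open>\<phi>\<close>.\<close>

definition dests :: "algorithm \<Rightarrow> (point \<Rightarrow> point) \<Rightarrow> point multiset \<Rightarrow> point \<Rightarrow> point set" where
  "dests A \<phi> C P = inv \<phi> ` A (image_mset \<phi> C) (\<phi> P)"

definition canonical :: "algorithm \<Rightarrow> bool" where
  "canonical A \<longleftrightarrow>
     (\<forall>C. \<forall>P\<in>#C. finite (A C P) \<and> A C P \<noteq> {}) \<and>
     (\<forall>C. \<forall>P\<in>#C. \<forall>Q\<in>#C. P \<noteq> Q \<longrightarrow>
        (\<forall>\<phi>\<in>frames. \<forall>\<psi>\<in>frames. dests A \<phi> C P \<inter> dests A \<psi> C Q = {}))"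

text \<open>
  The names \<open>0, \<dots>, n - 1\<close> of the robots serve the analysis only; a placement assigns
  positions to them, and its values outside \<open>{..<n}\<close> are irrelevant.
\<close>

type_synonym placement = "nat \<Rightarrow> point"

definition config :: "nat \<Rightarrow> placement \<Rightarrow> point multiset" where
  "config n x = image_mset x (mset_set {..<n})"

definition scattered :: "point multiset \<Rightarrow> bool" where
  "scattered C \<longleftrightarrow> (\<forall>P\<in>#C. count C P = 1)"

text \<open>
  The local coordinate systems are chosen by an adversary, anew in each round and knowing the
  whole past (a list of placements, most recent first). They are indexed by positions because
  robots at the same point share their coordinate system.
\<close>

type_synonym adversary = "placement list \<Rightarrow> point \<Rightarrow> (point \<Rightarrow> point)"

definition admissible :: "adversary \<Rightarrow> bool" where
  "admissible adv \<longleftrightarrow> (\<forall>h P. adv h P \<in> frames)"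

text \<open>
  One fully synchronous round: the robots choose independently and uniformly among their
  destinations, and each reaches the point it has chosen (rigid moves).
\<close>

definition step :: "algorithm \<Rightarrow> (point \<Rightarrow> (point \<Rightarrow> point)) \<Rightarrow> nat \<Rightarrow> placement \<Rightarrow> placement pmf" where
  "step A F n x =
     Pi_pmf {..<n} 0 (\<lambda>i. pmf_of_set (dests A (F (x i)) (config n x) (x i)))"

text \<open>Distribution of the history after \<open>t\<close> rounds, most recent placement first.\<close>

primrec run :: "algorithm \<Rightarrow> adversary \<Rightarrow> nat \<Rightarrow> placement \<Rightarrow> nat \<Rightarrow> placement list pmf" where
  "run A adv n x 0 = return_pmf [x]"
| "run A adv n x (Suc t) =
     bind_pmf (run A adv n x t) (\<lambda>h. map_pmf (\<lambda>y. y # h) (step A (adv h) n (hd h)))"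

definition has_scattered :: "nat \<Rightarrow> placement list \<Rightarrow> bool" where
  "has_scattered n h \<longleftrightarrow> (\<exists>x\<in>set h. scattered (config n x))"

text \<open>
  By continuity of measure, the limit below is the probability that a scattered configuration is
  ever reached.
\<close>

definition scattering :: "algorithm \<Rightarrow> bool" where
  "scattering A \<longleftrightarrow> (\<forall>n x adv. admissible adv \<longrightarrow>
     (\<lambda>t. measure_pmf.prob (run A adv n x t) {h. has_scattered n h}) \<longlonglongrightarrow> 1)"

text \<open>
  Random bits used in the round played after history \<open>h\<close>. Robots alone at their position are
  not counted, and counting stops once a scattered configuration has been reached.
\<close>

definition round_bits :: "algorithm \<Rightarrow> adversary \<Rightarrow> nat \<Rightarrow> placement list \<Rightarrow> real" where
  "round_bits A adv n h =
     (if has_scattered n h then 0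
      else let x = hd h; C = config n x in
        \<Sum>i<n. if count C (x i) = 1 then 0
              else log 2 (real (dest_count A (image_mset (adv h (x i)) C) (adv h (x i) (x i)))))"

text \<open>
  The expectation of the total number of bits, as the sum over all rounds of the expectations
  (the summands are nonnegative for canonical algorithms).
\<close>

definition expected_bits :: "algorithm \<Rightarrow> adversary \<Rightarrow> nat \<Rightarrow> placement \<Rightarrow> ennreal" where
  "expected_bits A adv n x =
     (\<Sum>t. \<integral>\<^sup>+ h. ennreal (round_bits A adv n h) \<partial>measure_pmf (run A adv n x t))"

end

theory Submission
  imports Defs
begin

text \<open>
  Give a robot whose position hosts \<open>m\<close> robots the potential \<open>5 log\<^sub>2 m + 2 M [m \<ge> 2]\<close>, where
  \<open>M = (K + 1) log\<^sub>2 n\<close> bounds the number of bits that a robot uses in one round. Groups never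
  merge, so if the \<open>m\<close> robots of a group choose among \<open>k\<close> destinations, the expected size of
  the new group of each of them is at most \<open>\<mu> = 1 + (m - 1) / k\<close>. If \<open>k < 2 m\<close>, Jensen's
  inequality makes the logarithmic term drop by \<open>5 log\<^sub>2 (m / \<mu>) \<ge> log\<^sub>2 k\<close>; if \<open>k \<ge> 2 m\<close>, the
  robot becomes alone with probability at least \<open>1 / 2\<close>, and the second term drops by
  \<open>M \<ge> log\<^sub>2 k\<close>. Hence the expected number of bits used in a round is at most the expected drop of
  the total potential, which is initially \<open>O(n log n)\<close>.
\<close>

section \<open>Potential of one robot and its expected drop in a round\<close>

definition robot_potential :: "real \<Rightarrow> nat \<Rightarrow> real" where
  "robot_potential M m = 5 * log 2 (real m) + 2 * M * of_bool (m \<ge> 2)"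

definition potential :: "real \<Rightarrow> nat \<Rightarrow> placement \<Rightarrow> real" where
  "potential M n x = (\<Sum>i<n. robot_potential M (count (config n x) (x i)))"

text \<open>Concavity: the graph of \<open>log 2\<close> lies below its tangent at \<mu>. As the
  bound is affine in \<open>x\<close>, it can be integrated directly, which gives Jensen's
  inequality.\<close>

lemma log2_le_tangent:
  fixes x \<mu> :: real
  assumes "x > 0" "\<mu> > 0"
  shows "log 2 x \<le> log 2 \<mu> + (x - \<mu>) / (\<mu> * ln 2)"
proof -
  have "ln x - ln \<mu> \<le> (x - \<mu>) / \<mu>"
    using ln_diff_le[of x \<mu>] assms by simp
  then have "(ln x - ln \<mu>) / ln 2 \<le> (x - \<mu>) / \<mu> / ln 2"
    by (intro divide_right_mono) auto
  then show ?thesis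
    using assms by (simp add: log_def diff_divide_distrib[of "ln x"] mult.commute)
qed

text \<open>With \<open>r = m / (1 + (m - 1) / k)\<close>, the factor by which the group shrinks,
  the claim is \<open>k \<le> r ^ 5\<close>. It follows from \<open>k \<le> 3 * r\<close> and
  \<open>3 \<le> r ^ 4\<close>, the latter because \<open>r \<ge> 4 / 3\<close>, with equality at
  \<open>k = m = 2\<close>.\<close>

lemma log2_le_log2_group_ratio:
  fixes k m :: real
  assumes "k \<ge> 2" "m \<ge> 2" "k \<le> 2 * m"
  shows "log 2 k \<le> 5 * (log 2 m - log 2 (1 + (m - 1) / k))"
proof -
  define r where "r = m / (1 + (m - 1) / k)"
  have \<mu>: "1 + (m - 1) / k > 0"
    using assms by (simp add: add_pos_nonneg)
  have r: "r = m * k / (k + m - 1)"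
    using assms by (simp add: r_def field_simps)
  \<comment> \<open>Once this product is expanded, the bound on \<open>r\<close> is a linear
    consequence in \<open>m * k\<close>, \<open>k\<close> and \<open>m\<close>.\<close>
  have "(k - 2) * (m - 2) \<ge> 0"
    using assms by simp
  then have "4 * (k + m - 1) \<le> 3 * (m * k)"
    using assms by (simp add: algebra_simps)
  then have r43: "r \<ge> 4 / 3"
    using assms by (simp add: r field_simps)
  have "k * (k + m - 1) \<le> k * (3 * m)"
    using assms by (intro mult_left_mono) auto
  then have "k \<le> 3 * r"
    using assms by (simp add: r field_simps)
  \<comment> \<open>\<open>(4 / 3) ^ 4 = 256 / 81\<close> exceeds 3; this is where the factor 5 of
    the potential comes from.\<close>
  also have "(4 / 3) ^ 4 \<le> r ^ 4"
    using r43 by (intro power_mono) auto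
  then have "3 * r \<le> r ^ 4 * r"
    using r43 by (intro mult_right_mono) (auto simp: power_divide)
  finally have "k \<le> r ^ 5"
    by (simp add: eval_nat_numeral mult_ac)
  then have "log 2 k \<le> log 2 (r ^ 5)"
    using assms r43 by simp
  also have "\<dots> = 5 * log 2 r"
    using r43 by (simp add: log_nat_power)
  also have "log 2 r = log 2 m - log 2 (1 + (m - 1) / k)"
    unfolding r_def using assms \<mu> by (simp add: log_divide)
  finally show ?thesis .
qed

text \<open>Here \<open>N\<close> is the size of the robot's new group. The round enters only
  through the bound \<open>E\<close> on the mean of \<open>N\<close>, so neither geometry nor
  independence appears.\<close>

lemma expectation_robot_potential_le:
  fixes p :: "'a pmf" and N :: "'a \<Rightarrow> nat"
  assumes fin: "finite (set_pmf p)" and N: "\<And>y. y \<in> set_pmf p \<Longrightarrow> N y \<ge> 1"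
    and E: "measure_pmf.expectation p (\<lambda>y. real (N y)) \<le> 1 + (real m - 1) / real k"
    and m: "m \<ge> 1" and k: "k \<ge> 1" and M: "log 2 (real k) \<le> M"
  shows "measure_pmf.expectation p (\<lambda>y. robot_potential M (N y))
    \<le> robot_potential M m - (if m = 1 then 0 else log 2 (real k))"
proof -
  define \<mu> where "\<mu> = 1 + (real m - 1) / real k"
  have int [simp]: "integrable (measure_pmf p) f" for f :: "'a \<Rightarrow> real"
    using fin by (rule integrable_measure_pmf_finite)
  have mono: "measure_pmf.expectation p f \<le> measure_pmf.expectation p g"
    if "\<And>y. y \<in> set_pmf p \<Longrightarrow> f y \<le> g y" for f g :: "'a \<Rightarrow> real"
    using that by (intro integral_mono_AE) (auto simp: AE_measure_pmf_iff)
  have \<mu>1: "\<mu> \<ge> 1"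
    using m k by (simp add: \<mu>_def)
  have k0: "log 2 (real k) \<ge> 0"
    using k by simp
  have "measure_pmf.expectation p (\<lambda>y. log 2 (N y))
      \<le> measure_pmf.expectation p (\<lambda>y. log 2 \<mu> + (real (N y) - \<mu>) / (\<mu> * ln 2))"
    using N \<mu>1 by (intro mono log2_le_tangent) (auto simp: Suc_le_eq)
  also have "\<dots> = log 2 \<mu> + (measure_pmf.expectation p (\<lambda>y. real (N y)) - \<mu>) / (\<mu> * ln 2)"
    by simp
  \<comment> \<open>The tangent has positive slope, so an upper bound on the mean is enough.\<close>
  also have "\<dots> \<le> log 2 \<mu>"
    using E \<mu>1 by (simp add: \<mu>_def divide_le_0_iff)
  finally have Elog: "measure_pmf.expectation p (\<lambda>y. log 2 (N y)) \<le> log 2 \<mu>" .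
  \<comment> \<open>Markov's inequality for \<open>N y - 1\<close>, the number of
    companions.\<close>
  have "measure_pmf.expectation p (\<lambda>y. of_bool (N y \<ge> 2))
      \<le> measure_pmf.expectation p (\<lambda>y. real (N y) - 1)"
    using N by (intro mono) (auto simp: of_bool_def)
  also have "\<dots> \<le> (real m - 1) / real k"
    using E by simp
  finally have Ebool: "measure_pmf.expectation p (\<lambda>y. of_bool (N y \<ge> 2)) \<le> (real m - 1) / real k" .
  have "measure_pmf.expectation p (\<lambda>y. of_bool (N y \<ge> 2))
      \<le> measure_pmf.expectation p (\<lambda>y. 1 :: real)"
    by (intro mono) auto
  then have Ebool1: "measure_pmf.expectation p (\<lambda>y. of_bool (N y \<ge> 2)) \<le> (1 :: real)"
    by simp
  have eq: "measure_pmf.expectation p (\<lambda>y. robot_potential M (N y))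
      = 5 * measure_pmf.expectation p (\<lambda>y. log 2 (N y))
        + 2 * M * measure_pmf.expectation p (\<lambda>y. of_bool (N y \<ge> 2))"
    by (simp add: robot_potential_def)
  \<comment> \<open>The bound \<open>b\<close> stays free: the cases below take the mean number of
    companions, the trivial bound 1, or 1 / 2. Multiplying by \<open>2 * M\<close> is monotone since
    \<open>0 \<le> log 2 k \<le> M\<close>.\<close>
  have bound: "measure_pmf.expectation p (\<lambda>y. robot_potential M (N y)) \<le> 5 * log 2 \<mu> + 2 * M * b"
    if "measure_pmf.expectation p (\<lambda>y. of_bool (N y \<ge> 2)) \<le> b" for b
    unfolding eq using Elog that M k0 by (intro add_mono mult_left_mono) auto
  \<comment> \<open>A lone robot stays alone and pays nothing. For \<open>k = 1\<close> no bits are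
    used and \<mu> is \<open>m\<close>. For \<open>2 \<le> k \<le> 2 * m\<close> the logarithmic
    term pays; for larger \<open>k\<close> the indicator term drops by \<open>M\<close> while \<mu>
    is still at most \<open>m\<close>.\<close>
  consider "m = 1" | "m \<ge> 2" "k = 1" | "m \<ge> 2" "k \<ge> 2" "k \<le> 2 * m" | "m \<ge> 2" "k > 2 * m"
    using m k by linarith
  then show ?thesis
  proof cases
    case 1
    then show ?thesis
      using bound[OF Ebool] by (simp add: robot_potential_def \<mu>_def)
  next
    case 2
    then show ?thesis
      using bound[OF Ebool1] by (simp add: robot_potential_def \<mu>_def)
  next
    case 3
    then have "log 2 (real k) \<le> 5 * (log 2 (real m) - log 2 \<mu>)"
      unfolding \<mu>_def by (intro log2_le_log2_group_ratio) auto
    then show ?thesis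
      using bound[OF Ebool1] 3 by (simp add: robot_potential_def)
  next
    case 4
    have "(real m - 1) / real k \<le> 1 / 2"
      using 4 by (simp add: field_simps)
    then have "measure_pmf.expectation p (\<lambda>y. robot_potential M (N y))
        \<le> 5 * log 2 \<mu> + 2 * M * (1 / 2)"
      using Ebool by (intro bound) linarith
    moreover have "\<mu> \<le> real m"
    proof -
      have "(real m - 1) / real k \<le> (real m - 1) / 1"
        using m k by (intro divide_left_mono) auto
      then show ?thesis by (simp add: \<mu>_def)
    qed
    then have "log 2 \<mu> \<le> log 2 (real m)"
      using \<mu>1 by simp
    ultimately show ?thesis
      using 4 M by (simp add: robot_potential_def)
  qed
qed

section \<open>One synchronous round of all robots\<close>

lemma count_config: "real (count (config n x) P) = (\<Sum>j<n. of_bool (x j = P))"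
  by (induction n) (auto simp: config_def lessThan_Suc)

lemma set_mset_config: "set_mset (config n x) = x ` {..<n}"
  by (simp add: config_def)

lemma size_config [simp]: "size (config n x) = n"
  by (simp add: config_def)

lemma count_config_ge_1: "i < n \<Longrightarrow> count (config n x) (x i) \<ge> 1"
  by (simp add: Suc_le_eq set_mset_config)

text \<open>Frames are bijections, so \<open>inv \<phi>\<close> is injective and the number of
  destinations is the same in local and in global coordinates.\<close>

lemma dests_canonical:
  assumes "canonical A" "\<phi> \<in> frames" "P \<in># C"
  shows "finite (dests A \<phi> C P)" "dests A \<phi> C P \<noteq> {}"
    and "card (dests A \<phi> C P) = dest_count A (image_mset \<phi> C) (\<phi> P)"
proof -
  have "\<phi> P \<in># image_mset \<phi> C"
    using assms(3) by simp
  then have "finite (A (image_mset \<phi> C) (\<phi> P))" "A (image_mset \<phi> C) (\<phi> P) \<noteq> {}"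
    using assms(1) unfolding canonical_def by blast+
  moreover have "inj (inv \<phi>)"
    using assms(2) by (simp add: frames_def bij_imp_bij_inv bij_is_inj)
  ultimately show "finite (dests A \<phi> C P)" "dests A \<phi> C P \<noteq> {}"
      "card (dests A \<phi> C P) = dest_count A (image_mset \<phi> C) (\<phi> P)"
    by (auto simp: dests_def dest_count_def intro!: card_image intro: inj_on_subset)
qed

text \<open>Fix all choices but that of \<open>i\<close>: then \<open>y j\<close> is a fixed point,
  which a uniform choice from \<open>D\<close> hits with probability \<open>1 / card D\<close> or
  0.\<close>

lemma prob_Pi_pmf_uniform_coincide_le:
  assumes "finite I" "i \<in> I" "i \<noteq> j" "finite D" "D \<noteq> {}" "p i = pmf_of_set D"
  shows "measure_pmf.expectation (Pi_pmf I d p) (\<lambda>y. of_bool (y j = y i)) \<le> 1 / real (card D)"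
proof -
  have I: "I = insert i (I - {i})"
    using assms by auto
  have "Pi_pmf I d p = bind_pmf (p i) (\<lambda>v. bind_pmf (Pi_pmf (I - {i}) d p) (\<lambda>f. return_pmf (f(i := v))))"
    by (subst I, subst Pi_pmf_insert') (use assms in auto)
  \<comment> \<open>Commuting the two draws makes \<open>i\<close> choose last.\<close>
  also have "\<dots> = bind_pmf (Pi_pmf (I - {i}) d p) (\<lambda>f. map_pmf (\<lambda>v. f(i := v)) (p i))"
    by (subst bind_commute_pmf) (simp add: map_pmf_def)
  finally have "emeasure (measure_pmf (Pi_pmf I d p)) {y. y j = y i}
      = (\<integral>\<^sup>+ f. emeasure (measure_pmf (p i)) {v. f j = v} \<partial>measure_pmf (Pi_pmf (I - {i}) d p))"
    using assms(3) by (simp add: vimage_def)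
  also have "\<dots> \<le> (\<integral>\<^sup>+ f. ennreal (1 / real (card D)) \<partial>measure_pmf (Pi_pmf (I - {i}) d p))"
    using assms(4-6) by (intro nn_integral_mono) (simp add: emeasure_pmf_single divide_right_mono indicator_def ennreal_leI)
  finally have le: "measure_pmf.prob (Pi_pmf I d p) {y. y j = y i} \<le> 1 / real (card D)"
    by (simp add: measure_pmf.emeasure_eq_measure)
  have eq: "(\<lambda>y. of_bool (y j = y i)) = (indicator {y. y j = y i} :: _ \<Rightarrow> real)"
    by (auto simp: indicator_def)
  show ?thesis
    unfolding eq using le by simp
qed

text \<open>By linearity of expectation over the robots, it suffices to bound the mean size of each
  new group. That size is a sum of coincidence indicators: robot \<open>i\<close> itself contributes
  1, each former companion at most \<open>1 / card (D i)\<close>, every other robot 0.\<close>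

lemma step_round:
  fixes F :: "point \<Rightarrow> point \<Rightarrow> point"
  assumes A: "canonical A" and F: "\<And>P. F P \<in> frames"
    and M: "\<And>P. P \<in># config n x \<Longrightarrow>
      log 2 (real (dest_count A (image_mset (F P) (config n x)) (F P P))) \<le> M"
  shows "measure_pmf.expectation (step A F n x) (potential M n)
      \<le> potential M n x - (\<Sum>i<n. if count (config n x) (x i) = 1 then 0
          else log 2 (real (dest_count A (image_mset (F (x i)) (config n x)) (F (x i) (x i)))))"
    and "finite (set_pmf (step A F n x))"
proof -
  define D where "D i = dests A (F (x i)) (config n x) (x i)" for i
  have xi: "x i \<in># config n x" if "i < n" for i
    using that by (simp add: set_mset_config)
  have D: "finite (D i)" "D i \<noteq> {}"
      "card (D i) = dest_count A (image_mset (F (x i)) (config n x)) (F (x i) (x i))" if "i < n" for i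
    unfolding D_def using dests_canonical[OF A F xi[OF that]] by auto
  have step: "step A F n x = Pi_pmf {..<n} 0 (\<lambda>i. pmf_of_set (D i))"
    by (simp add: step_def D_def)
  have set_step: "set_pmf (step A F n x) = PiE_dflt {..<n} 0 D"
    unfolding step by (subst set_Pi_pmf) (auto simp: PiE_dflt_def D)
  then show fin: "finite (set_pmf (step A F n x))"
    using D by auto
  note int = integrable_measure_pmf_finite[OF fin]
  \<comment> \<open>Groups never merge: canonicity separates the destination sets of distinct
    positions even when their frames differ.\<close>
  have disj: "y j \<noteq> y i" if "y \<in> set_pmf (step A F n x)" "i < n" "j < n" "x j \<noteq> x i" for y i j
  proof -
    have "D j \<inter> D i = {}"
      using A F that(4) xi[OF that(2)] xi[OF that(3)] unfolding canonical_def D_def by blast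
    moreover have "y i \<in> D i" "y j \<in> D j"
      using that by (auto simp: set_step PiE_dflt_def)
    ultimately show ?thesis
      by auto
  qed
  have size: "measure_pmf.expectation (step A F n x) (\<lambda>y. real (count (config n y) (y i)))
      \<le> 1 + (real (count (config n x) (x i)) - 1) / real (card (D i))" if i: "i < n" for i
  proof -
    have "measure_pmf.expectation (step A F n x) (\<lambda>y. real (count (config n y) (y i)))
        = (\<Sum>j<n. measure_pmf.expectation (step A F n x) (\<lambda>y. of_bool (y j = y i)))"
      unfolding count_config by (intro Bochner_Integration.integral_sum int)
    also have "\<dots> = 1 + (\<Sum>j\<in>{..<n}-{i}.
        measure_pmf.expectation (step A F n x) (\<lambda>y. of_bool (y j = y i)))"
      using i by (subst sum.remove[of _ i]) auto
    also have "(\<Sum>j\<in>{..<n}-{i}. measure_pmf.expectation (step A F n x) (\<lambda>y. of_bool (y j = y i)))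
        \<le> (\<Sum>j\<in>{..<n}-{i}. of_bool (x j = x i) / real (card (D i)))"
    proof (rule sum_mono)
      fix j assume j: "j \<in> {..<n} - {i}"
      show "measure_pmf.expectation (step A F n x) (\<lambda>y. of_bool (y j = y i))
          \<le> of_bool (x j = x i) / real (card (D i))"
      proof (cases "x j = x i")
        case True
        then show ?thesis
          unfolding step using prob_Pi_pmf_uniform_coincide_le[of "{..<n}" i j "D i"] i j D[OF i]
          by auto
      next
        case False
        then have "measure_pmf.expectation (step A F n x) (\<lambda>y. of_bool (y j = y i) :: real)
            = measure_pmf.expectation (step A F n x) (\<lambda>y. 0)"
          using disj i j by (intro integral_cong_AE) (auto simp: AE_measure_pmf_iff)
        then show ?thesis
          by simp
      qed
    qed
    \<comment> \<open>The omitted index \<open>i\<close> would contribute 1, hence the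
      \<open>- 1\<close>.\<close>
    also have "\<dots> = ((\<Sum>j<n. of_bool (x j = x i)) - 1) / real (card (D i))"
      using i by (subst (2) sum.remove[of _ i]) (simp_all add: sum_divide_distrib del: sum_of_bool_eq)
    finally show ?thesis
      by (simp add: count_config)
  qed
  have "measure_pmf.expectation (step A F n x) (potential M n)
      = (\<Sum>i<n. measure_pmf.expectation (step A F n x)
          (\<lambda>y. robot_potential M (count (config n y) (y i))))"
    unfolding potential_def by (intro Bochner_Integration.integral_sum int)
  also have "\<dots> \<le> (\<Sum>i<n. robot_potential M (count (config n x) (x i))
      - (if count (config n x) (x i) = 1 then 0 else log 2 (real (card (D i)))))"
  proof (intro sum_mono expectation_robot_potential_le fin)
    fix i assume "i \<in> {..<n}"
    then have i: "i < n" by simp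
    show "measure_pmf.expectation (step A F n x) (\<lambda>y. real (count (config n y) (y i)))
        \<le> 1 + (real (count (config n x) (x i)) - 1) / real (card (D i))"
      by (rule size[OF i])
    show "card (D i) \<ge> 1"
      using D(1,2)[OF i] by (simp add: Suc_le_eq card_gt_0_iff)
    show "log 2 (real (card (D i))) \<le> M"
      using M[OF xi[OF i]] D(3)[OF i] by simp
    show "count (config n x) (x i) \<ge> 1" "count (config n y) (y i) \<ge> 1" for y
      using i by (rule count_config_ge_1)+
  qed
  also have "\<dots> = potential M n x - (\<Sum>i<n. if count (config n x) (x i) = 1 then 0
          else log 2 (real (dest_count A (image_mset (F (x i)) (config n x)) (F (x i) (x i)))))"
    unfolding potential_def sum_subtractf by (intro arg_cong2[where f = "(-)"] sum.cong refl) (auto simp: D)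
  finally show "measure_pmf.expectation (step A F n x) (potential M n) \<le> \<dots>" .
qed

section \<open>Summation over all rounds\<close>

lemma potential_nonneg: "M \<ge> 0 \<Longrightarrow> potential M n x \<ge> 0"
  unfolding potential_def robot_potential_def
  using count_config_ge_1[of _ n x]
  by (intro sum_nonneg add_nonneg_nonneg mult_nonneg_nonneg) (auto simp: Suc_le_eq)

lemma potential_le:
  assumes "n \<ge> 1" "M \<ge> 0"
  shows "potential M n x \<le> real n * (5 * log 2 (real n) + 2 * M)"
proof -
  have "robot_potential M (count (config n x) (x i)) \<le> 5 * log 2 (real n) + 2 * M" if "i < n" for i
  proof -
    have "count (config n x) (x i) \<le> n"
      using count_le_size[of "config n x" "x i"] by simp
    then have "log 2 (count (config n x) (x i)) \<le> log 2 (real n)"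
      using count_config_ge_1[OF that, of x] assms by simp
    then show ?thesis
      using assms by (auto simp: robot_potential_def of_bool_def)
  qed
  then show ?thesis
    unfolding potential_def
    using sum_bounded_above[of "{..<n}" "\<lambda>i. robot_potential M (count (config n x) (x i))"] by simp
qed

text \<open>The expected cost of a round is at most the expected drop of the potential, so the costs
  telescope; nonnegativity of the potential bounds all partial sums by its initial value.\<close>

lemma expected_bits_le:
  assumes A: "canonical A" and adv: "admissible adv" and "n \<ge> 1" "M \<ge> 0"
    and M: "\<And>C P. size C = n \<Longrightarrow> P \<in># C \<Longrightarrow> log 2 (real (dest_count A C P)) \<le> M"
  shows "expected_bits A adv n x \<le> ennreal (potential M n x)"
proof -
  let ?R = "run A adv n x"
  have round: "ennreal (round_bits A adv n h)
      + (\<integral>\<^sup>+ y. ennreal (potential M n y) \<partial>measure_pmf (step A (adv h) n (hd h)))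
      \<le> ennreal (potential M n (hd h))" for h
  proof -
    let ?s = "step A (adv h) n (hd h)"
    let ?cost = "\<Sum>i<n. if count (config n (hd h)) (hd h i) = 1 then 0
      else log 2 (real (dest_count A (image_mset (adv h (hd h i)) (config n (hd h)))
        (adv h (hd h i) (hd h i))))"
    have F: "adv h P \<in> frames" for P
      using adv by (simp add: admissible_def)
    have MF: "log 2 (real (dest_count A (image_mset (adv h P) (config n (hd h))) (adv h P P))) \<le> M"
      if "P \<in># config n (hd h)" for P
      using that by (intro M) auto
    note sr = step_round[OF A F MF]
    have E0: "measure_pmf.expectation ?s (potential M n) \<ge> 0"
      using potential_nonneg[OF \<open>M \<ge> 0\<close>] by (intro integral_nonneg_AE) auto
    \<comment> \<open>At least one destination makes each logarithm nonnegative, so that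
      \<open>ennreal\<close> truncates nothing.\<close>
    have card: "1 \<le> dest_count A (image_mset (adv h (hd h i)) (config n (hd h)))
        (adv h (hd h i) (hd h i))" if "i < n" for i
    proof -
      have "hd h i \<in># config n (hd h)"
        using that by (simp add: set_mset_config)
      note D = dests_canonical[OF A F this]
      from D(1,2) show ?thesis
        unfolding D(3)[symmetric] by (simp add: Suc_le_eq card_gt_0_iff)
    qed
    \<comment> \<open>After scattering \<open>round_bits\<close> is 0, so it is below
      \<open>?cost\<close> for every history, and \<open>round\<close> needs no case
      distinction.\<close>
    have cost: "?cost \<ge> 0"
      using card by (intro sum_nonneg) (simp add: Suc_le_eq)
    then have bits: "0 \<le> round_bits A adv n h" "round_bits A adv n h \<le> ?cost"
      by (auto simp: round_bits_def Let_def)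
    have "(\<integral>\<^sup>+ y. ennreal (potential M n y) \<partial>measure_pmf ?s)
        = ennreal (measure_pmf.expectation ?s (potential M n))"
      using potential_nonneg[OF \<open>M \<ge> 0\<close>]
      by (intro nn_integral_eq_integral integrable_measure_pmf_finite sr) auto
    then have "ennreal (round_bits A adv n h)
      + (\<integral>\<^sup>+ y. ennreal (potential M n y) \<partial>measure_pmf ?s)
      = ennreal (round_bits A adv n h + measure_pmf.expectation ?s (potential M n))"
      using bits E0 by (simp add: ennreal_plus)
    also have "\<dots> \<le> ennreal (potential M n (hd h))"
      using sr(1) bits by (intro ennreal_leI) linarith
    finally show ?thesis .
  qed
  \<comment> \<open>The remaining expected potential is kept in the invariant for the induction and
    discarded only at the end.\<close>
  have partial: "(\<Sum>t<T. \<integral>\<^sup>+ h. ennreal (round_bits A adv n h) \<partial>measure_pmf (?R t))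
      + (\<integral>\<^sup>+ h. ennreal (potential M n (hd h)) \<partial>measure_pmf (?R T)) \<le> ennreal (potential M n x)" for T
  proof (induction T)
    case 0
    then show ?case by simp
  next
    case (Suc T)
    \<comment> \<open>Round \<open>T + 1\<close> is integrated conditionally on the history
      \<open>h\<close>; the head of the extended history \<open>y # h\<close> is
      \<open>y\<close>.\<close>
    have "(\<integral>\<^sup>+ h. ennreal (round_bits A adv n h) \<partial>measure_pmf (?R T))
        + (\<integral>\<^sup>+ h. ennreal (potential M n (hd h)) \<partial>measure_pmf (?R (Suc T)))
        = (\<integral>\<^sup>+ h. ennreal (round_bits A adv n h)
          + (\<integral>\<^sup>+ y. ennreal (potential M n y) \<partial>measure_pmf (step A (adv h) n (hd h))) \<partial>measure_pmf (?R T))"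
      by (simp add: nn_integral_add)
    also have "\<dots> \<le> (\<integral>\<^sup>+ h. ennreal (potential M n (hd h)) \<partial>measure_pmf (?R T))"
      by (intro nn_integral_mono round)
    finally have "(\<Sum>t<T. \<integral>\<^sup>+ h. ennreal (round_bits A adv n h) \<partial>measure_pmf (?R t))
        + ((\<integral>\<^sup>+ h. ennreal (round_bits A adv n h) \<partial>measure_pmf (?R T))
        + (\<integral>\<^sup>+ h. ennreal (potential M n (hd h)) \<partial>measure_pmf (?R (Suc T))))
        \<le> (\<Sum>t<T. \<integral>\<^sup>+ h. ennreal (round_bits A adv n h) \<partial>measure_pmf (?R t))
        + (\<integral>\<^sup>+ h. ennreal (potential M n (hd h)) \<partial>measure_pmf (?R T))"
      by (intro add_left_mono)
    with Suc show ?case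
      by (simp only: sum.lessThan_Suc add.assoc)
  qed
  show ?thesis
    unfolding expected_bits_def
  proof (rule suminf_le_const[OF summableI])
    fix T
    show "(\<Sum>t<T. \<integral>\<^sup>+ h. ennreal (round_bits A adv n h) \<partial>measure_pmf (?R t))
        \<le> ennreal (potential M n x)"
      using partial[of T] by (rule order.trans[rotated]) simp
  qed
qed

theorem theorem3:
  fixes A :: algorithm and K :: nat
  assumes "canonical A" and "scattering A"
    and "\<exists>c::real. \<forall>\<^sub>F n in at_top. \<forall>C P. size C = n \<and> P \<in># C \<longrightarrow>
           real (dest_count A C P) \<le> c * real n ^ K"
  shows "\<exists>c::real. \<forall>\<^sub>F n in at_top. \<forall>x adv. admissible adv \<longrightarrow>
           expected_bits A adv n x \<le> ennreal (c * (real n * log 2 (real n)))"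
proof -
  obtain c :: real where c: "\<forall>\<^sub>F n in at_top. \<forall>C P. size C = n \<and> P \<in># C \<longrightarrow>
      real (dest_count A C P) \<le> c * real n ^ K"
    using assms(3) by blast
  \<comment> \<open>Requiring \<open>n \<ge> c\<close> absorbs the constant,
    \<open>c * n ^ K \<le> n ^ Suc K\<close>, which gives \<open>M = (K + 1) * log 2 n\<close>. The
    initial potential then yields \<open>5 + 2 * (K + 1) = 7 + 2 * K\<close>.\<close>
  have "\<forall>\<^sub>F n in at_top. \<forall>x adv. admissible adv \<longrightarrow>
      expected_bits A adv n x \<le> ennreal ((7 + 2 * real K) * (real n * log 2 (real n)))"
    using c eventually_ge_at_top[of "nat \<lceil>c\<rceil>"] eventually_ge_at_top[of 1]
  proof eventually_elim
    case (elim n)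
    define M where "M = real (Suc K) * log 2 (real n)"
    have M0: "M \<ge> 0"
      using elim(3) by (simp add: M_def)
    have M: "log 2 (real (dest_count A C P)) \<le> M" if "size C = n" "P \<in># C" for C P
    proof -
      have "A C P \<noteq> {} \<and> finite (A C P)"
        using assms(1) that(2) by (auto simp: canonical_def)
      then have "dest_count A C P > 0"
        by (simp add: dest_count_def card_gt_0_iff)
      moreover have "real (dest_count A C P) \<le> c * real n ^ K"
        using elim(1) that by blast
      moreover have "c * real n ^ K \<le> real n * real n ^ K"
        using elim(2) by (intro mult_right_mono) (linarith, simp)
      ultimately have "0 < dest_count A C P" "real (dest_count A C P) \<le> real n ^ Suc K"
        by simp_all
      then have "log 2 (real (dest_count A C P)) \<le> log 2 (real n ^ Suc K)"
        by simp
      also have "\<dots> = M"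
        using elim(3) by (simp add: M_def log_nat_power del: power_Suc)
      finally show ?thesis .
    qed
    show ?case
    proof (intro allI impI)
      fix x adv assume "admissible adv"
      then have "expected_bits A adv n x \<le> ennreal (potential M n x)"
        by (rule expected_bits_le[OF assms(1) _ elim(3) M0 M])
      also have "\<dots> \<le> ennreal (real n * (5 * log 2 (real n) + 2 * M))"
        using potential_le[OF elim(3) M0] by (rule ennreal_leI)
      also have "real n * (5 * log 2 (real n) + 2 * M)
          = (7 + 2 * real K) * (real n * log 2 (real n))"
        by (simp add: M_def algebra_simps)
      finally show "expected_bits A adv n x
          \<le> ennreal ((7 + 2 * real K) * (real n * log 2 (real n)))" .
    qed
  qed
  then show ?thesis
    by blast
qed

end
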